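(* Suppose that $v, w \in S_n$ are fully commutative permutations with $w = v s_i$, $\ell(w) = \ell(v) + 1$, and $i \in \operatorname{supp}(v)$. Suppose moreover that $P(v) \neq P(w)$. Then $w$ is a crowded permutation.
   Context: $s_i$ is the simple reflection swapping $i$ and $i+1$ (so $vs_i$ swaps the entries of $v$ in positions $i,i+1$); $\ell$ is Coxeter length (number of inversions). The support $\operatorname{supp}(v)$ is the set of letters appearing in reduced words of $v$; equivalently, $i \in \operatorname{supp}(v)$ iff $\{v(1),\dots,v(i)\} \neq \{1,\dots,i\}$. A permutation is fully commutative iff it avoids $321$. $P(w)$ is the RSK insertion tableau of $w$ (at most two rows for fully commutative $w$), and $\mathrm{Row}_2(T)$ is the set of entries in the second row of a tableau $T$. A set $L$ of integers is uncrowded if for all integers $x>0$ and $y$ we have $|[y,y+2x]\cap L| \le x+1$, and crowded otherwise. A fully commutative permutation $w$ is crowded (resp. uncrowded) if $\mathrm{Row}_2(P(w))$ is a crowded (resp. uncrowded) set. *)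

theory Defs
  imports "HOL-Combinatorics.Permutations"
begin

text \<open>
  The group \<open>S\<^sub>n\<close> consists of the functions \<open>v\<close> with \<open>v permutes {1..n}\<close>. Products are
  compositions of functions, so \<open>v \<circ> simple_refl i\<close> swaps the entries of \<open>v\<close> in
  positions \<open>i\<close> and \<open>i + 1\<close>.
\<close>

definition simple_refl :: "nat \<Rightarrow> nat \<Rightarrow> nat" where
  "simple_refl i = transpose i (Suc i)"

fun word_prod :: "nat list \<Rightarrow> nat \<Rightarrow> nat" where
  "word_prod [] = id"
| "word_prod (i # is) = simple_refl i \<circ> word_prod is"

definition is_word :: "nat \<Rightarrow> (nat \<Rightarrow> nat) \<Rightarrow> nat list \<Rightarrow> bool" where
  "is_word n v is \<longleftrightarrow> set is \<subseteq> {1..<n} \<and> word_prod is = v"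

definition coxeter_length :: "nat \<Rightarrow> (nat \<Rightarrow> nat) \<Rightarrow> nat" where
  "coxeter_length n v = (LEAST k. \<exists>is. is_word n v is \<and> length is = k)"

definition reduced_word :: "nat \<Rightarrow> (nat \<Rightarrow> nat) \<Rightarrow> nat list \<Rightarrow> bool" where
  "reduced_word n v is \<longleftrightarrow> is_word n v is \<and> length is = coxeter_length n v"

definition support :: "nat \<Rightarrow> (nat \<Rightarrow> nat) \<Rightarrow> nat set" where
  "support n v = (\<Union>is \<in> {is. reduced_word n v is}. set is)"

inductive commutation_move :: "nat list \<Rightarrow> nat list \<Rightarrow> bool" where
  "i + 1 < j \<or> j + 1 < i \<Longrightarrow> commutation_move (xs @ [i, j] @ ys) (xs @ [j, i] @ ys)"

text \<open>
  Any two reduced words are related by commutation moves; equivalently, the permutation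
  avoids the pattern 321 (lemma \<open>fully_commutative_iff\<close> below).
\<close>

definition fully_commutative :: "nat \<Rightarrow> (nat \<Rightarrow> nat) \<Rightarrow> bool" where
  "fully_commutative n v \<longleftrightarrow>
     (\<forall>xs ys. reduced_word n v xs \<longrightarrow> reduced_word n v ys \<longrightarrow> commutation_move\<^sup>*\<^sup>* xs ys)"

text \<open>
  A tableau is the list of its rows. Inserting \<open>x\<close> into a row replaces the leftmost entry
  greater than \<open>x\<close>, which is then inserted into the next row; if there is no such entry,
  \<open>x\<close> is appended.
\<close>

fun row_insert :: "nat \<Rightarrow> nat list \<Rightarrow> nat list \<times> nat option" where
  "row_insert x [] = ([x], None)"
| "row_insert x (y # ys) =
     (if x < y then (x # ys, Some y)
      else (case row_insert x ys of (r, b) \<Rightarrow> (y # r, b)))"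

fun tableau_insert :: "nat \<Rightarrow> nat list list \<Rightarrow> nat list list" where
  "tableau_insert x [] = [[x]]"
| "tableau_insert x (r # rs) =
     (case row_insert x r of
        (r', None) \<Rightarrow> r' # rs
      | (r', Some y) \<Rightarrow> r' # tableau_insert y rs)"

definition insertion_tableau :: "nat \<Rightarrow> (nat \<Rightarrow> nat) \<Rightarrow> nat list list" where
  "insertion_tableau n w = fold tableau_insert (map w [1..<Suc n]) []"

definition Row2 :: "nat list list \<Rightarrow> nat set" where
  "Row2 T = (if 2 \<le> length T then set (T ! 1) else {})"

definition uncrowded :: "int set \<Rightarrow> bool" where
  "uncrowded L \<longleftrightarrow> (\<forall>x y :: int. x > 0 \<longrightarrow> int (card ({y..y + 2 * x} \<inter> L)) \<le> x + 1)"

abbreviation crowded :: "int set \<Rightarrow> bool" where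
  "crowded L \<equiv> \<not> uncrowded L"

definition crowded_permutation :: "nat \<Rightarrow> (nat \<Rightarrow> nat) \<Rightarrow> bool" where
  "crowded_permutation n w \<longleftrightarrow>
     fully_commutative n w \<and> crowded (int ` Row2 (insertion_tableau n w))"


section \<open>Coxeter length is the number of inversions\<close>

definition inversions :: "nat \<Rightarrow> (nat \<Rightarrow> nat) \<Rightarrow> (nat \<times> nat) set" where
  "inversions n v = {(a, b). 1 \<le> a \<and> a < b \<and> b \<le> n \<and> v b < v a}"

lemma finite_inversions [simp]: "finite (inversions n v)"
  by (rule finite_subset[of _ "{1..n} \<times> {1..n}"]) (auto simp: inversions_def)

lemma inversions_id [simp]: "inversions n id = {}"
  by (auto simp: inversions_def)

lemma simple_refl_invol [simp]: "simple_refl i \<circ> simple_refl i = id"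
  by (simp add: simple_refl_def)

lemma simple_refl_invol' [simp]: "simple_refl i (simple_refl i x) = x"
  by (simp add: simple_refl_def)

lemma simple_refl_simps [simp]:
  "simple_refl i i = Suc i" "simple_refl i (Suc i) = i"
  "x \<noteq> i \<Longrightarrow> x \<noteq> Suc i \<Longrightarrow> simple_refl i x = x"
  by (auto simp: simple_refl_def)

lemma inj_simple_refl: "inj (simple_refl i)"
  by (metis injI simple_refl_invol')

lemma permutes_simple_refl:
  "i \<in> {1..<n} \<Longrightarrow> simple_refl i permutes {1..n}"
  by (auto simp: simple_refl_def intro!: permutes_swap_id)

lemma permutes_comp_simple_refl:
  "v permutes {1..n} \<Longrightarrow> i \<in> {1..<n} \<Longrightarrow> v \<circ> simple_refl i permutes {1..n}"
  by (intro permutes_compose permutes_simple_refl)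

lemma comp_simple_refl_twice [simp]: "v \<circ> simple_refl i \<circ> simple_refl i = v"
  by (simp add: comp_assoc)

lemma simple_refl_eq:
  "simple_refl i x = (if x = i then Suc i else if x = Suc i then i else x)"
  by auto

lemma inversions_comp_asc:
  assumes "i \<in> {1..<n}" "v i < v (Suc i)"
  shows "inversions n (v \<circ> simple_refl i) =
           insert (i, Suc i) (map_prod (simple_refl i) (simple_refl i) ` inversions n v)"
    (is "?L = ?R")
proof (rule set_eqI)
  fix p :: "nat \<times> nat"
  obtain a b where p: "p = (a, b)" by (cases p)
  have im: "(a, b) \<in> map_prod (simple_refl i) (simple_refl i) ` inversions n v \<longleftrightarrow>
              (simple_refl i a, simple_refl i b) \<in> inversions n v"
    by (force simp: image_iff)
  show "p \<in> ?L \<longleftrightarrow> p \<in> ?R"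
    using assms unfolding p insert_iff im
    by (auto simp: inversions_def simple_refl_eq split: if_splits)
qed

lemma card_inversions_asc:
  assumes "i \<in> {1..<n}" "v i < v (Suc i)"
  shows "card (inversions n (v \<circ> simple_refl i)) = Suc (card (inversions n v))"
proof -
  have "inj_on (map_prod (simple_refl i) (simple_refl i)) (inversions n v)"
    using inj_simple_refl by (meson inj_on_subset prod.inj_map subset_UNIV)
  moreover have "(i, Suc i) \<notin> map_prod (simple_refl i) (simple_refl i) ` inversions n v"
    by (auto simp: inversions_def simple_refl_eq split: if_splits)
  ultimately show ?thesis
    by (simp add: inversions_comp_asc[OF assms] card_image)
qed

lemma card_inversions_desc:
  assumes "i \<in> {1..<n}" "v (Suc i) < v i"
  shows "card (inversions n v) = Suc (card (inversions n (v \<circ> simple_refl i)))"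
  using card_inversions_asc[of i n "v \<circ> simple_refl i"] assms by simp

lemma word_prod_append: "word_prod (xs @ ys) = word_prod xs \<circ> word_prod ys"
  by (induction xs) (auto simp: comp_assoc)

lemma is_word_snoc:
  "is_word n v (xs @ [i]) \<longleftrightarrow> i \<in> {1..<n} \<and> is_word n (v \<circ> simple_refl i) xs"
proof -
  have "word_prod xs \<circ> simple_refl i = v \<longleftrightarrow> word_prod xs = v \<circ> simple_refl i"
    by (metis comp_simple_refl_twice)
  thus ?thesis by (auto simp: is_word_def word_prod_append)
qed

lemma is_word_permutes: "is_word n v xs \<Longrightarrow> v permutes {1..n}"
proof (induction xs arbitrary: v rule: rev_induct)
  case Nil
  hence "v = id" by (simp add: is_word_def)
  then show ?case by (simp only: permutes_id)
next
  case (snoc i xs)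
  then show ?case
    by (metis is_word_snoc comp_simple_refl_twice permutes_comp_simple_refl)
qed

lemma permutes_neq:
  "v permutes S \<Longrightarrow> x \<noteq> y \<Longrightarrow> v x \<noteq> v y"
  by (meson injD permutes_inj)

lemma inversions_le_word: "is_word n v xs \<Longrightarrow> card (inversions n v) \<le> length xs"
proof (induction xs arbitrary: v rule: rev_induct)
  case Nil
  hence "v = id" by (simp add: is_word_def)
  then show ?case by (simp only: inversions_id card.empty)
next
  case (snoc i xs)
  hence i: "i \<in> {1..<n}" and w: "is_word n (v \<circ> simple_refl i) xs" by (auto simp: is_word_snoc)
  have "v i < v (Suc i) \<or> v (Suc i) < v i"
    using permutes_neq[OF is_word_permutes[OF snoc.prems], of i "Suc i"] by linarith
  thus ?case
    using snoc.IH[OF w] card_inversions_asc[OF i, of v] card_inversions_desc[OF i, of v]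
    unfolding length_append_singleton by linarith
qed

lemma no_descent_id:
  assumes "v permutes {1..n}" "\<And>i. i \<in> {1..<n} \<Longrightarrow> v i < v (Suc i)"
  shows "v = id"
proof -
  have "i \<in> {1..n} \<Longrightarrow> i \<le> v i" for i
  proof (induction i)
    case (Suc i)
    show ?case
    proof (cases "i = 0")
      case True
      then show ?thesis using permutes_in_image[OF assms(1), of "Suc i"] Suc.prems by auto
    next
      case False
      then show ?thesis using Suc assms(2)[of i] by auto
    qed
  qed auto
  thus ?thesis using permutes_natset_ge[OF assms(1)] by auto
qed

lemma exists_word:
  assumes "v permutes {1..n}"
  shows "\<exists>xs. is_word n v xs \<and> length xs = card (inversions n v)"
  using assms
proof (induction "card (inversions n v)" arbitrary: v rule: less_induct)
  case less
  show ?case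
  proof (cases "\<exists>i\<in>{1..<n}. v (Suc i) < v i")
    case True
    then obtain i where i: "i \<in> {1..<n}" "v (Suc i) < v i" by blast
    note c = card_inversions_desc[OF i]
    obtain xs where "is_word n (v \<circ> simple_refl i) xs"
      "length xs = card (inversions n (v \<circ> simple_refl i))"
      using less.hyps[of "v \<circ> simple_refl i"] c permutes_comp_simple_refl[OF less.prems i(1)]
      by auto
    thus ?thesis using i c by (intro exI[of _ "xs @ [i]"]) (auto simp: is_word_snoc)
  next
    case False
    hence "v = id"
      using no_descent_id[OF less.prems] permutes_neq[OF less.prems]
      by (metis linorder_neqE_nat n_not_Suc_n)
    thus ?thesis
      by (intro exI[of _ "[]"]) (simp add: is_word_def)
  qed
qed

lemma coxeter_length_eq:
  assumes "v permutes {1..n}"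
  shows "coxeter_length n v = card (inversions n v)"
  unfolding coxeter_length_def
  using exists_word[OF assms] inversions_le_word by (intro Least_equality) auto

lemma reduced_word_iff:
  "reduced_word n v xs \<longleftrightarrow> is_word n v xs \<and> length xs = card (inversions n v)"
  unfolding reduced_word_def using coxeter_length_eq is_word_permutes by metis

lemma exists_reduced_word:
  "v permutes {1..n} \<Longrightarrow> \<exists>xs. reduced_word n v xs"
  using exists_word reduced_word_iff by blast

lemma reduced_word_snoc:
  "reduced_word n v (xs @ [i]) \<longleftrightarrow>
     i \<in> {1..<n} \<and> v (Suc i) < v i \<and> reduced_word n (v \<circ> simple_refl i) xs"
proof (cases "i \<in> {1..<n} \<and> is_word n (v \<circ> simple_refl i) xs")
  case True
  hence i: "i \<in> {1..<n}" and w: "is_word n (v \<circ> simple_refl i) xs" by auto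
  have "v permutes {1..n}"
    using True is_word_permutes is_word_snoc by blast
  hence "v i < v (Suc i) \<or> v (Suc i) < v i"
    using permutes_neq[of v "{1..n}" i "Suc i"] by linarith
  thus ?thesis
    using True inversions_le_word[OF w] card_inversions_asc[OF i, of v]
      card_inversions_desc[OF i, of v]
    by (auto simp: reduced_word_iff is_word_snoc)
qed (auto simp: reduced_word_iff is_word_snoc)


section \<open>Support in terms of one-line notation\<close>

lemma simple_refl_image: "j \<noteq> i \<Longrightarrow> j \<ge> 1 \<Longrightarrow> simple_refl j ` {1..i} = {1..i}"
proof -
  assume a: "j \<noteq> i" "j \<ge> 1"
  have "simple_refl j ` {1..i} \<subseteq> {1..i}" using a by (auto simp: simple_refl_eq)
  thus ?thesis
    by (metis card_image card_subset_eq finite_atLeastAtMost inj_on_subset inj_simple_refl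
        subset_UNIV)
qed

lemma word_avoids_image:
  "is_word n v xs \<Longrightarrow> i \<notin> set xs \<Longrightarrow> v ` {1..i} = {1..i}"
proof (induction xs arbitrary: v rule: rev_induct)
  case Nil
  then show ?case by (auto simp: is_word_def)
next
  case (snoc j xs)
  hence "is_word n (v \<circ> simple_refl j) xs" "i \<notin> set xs" by (auto simp: is_word_snoc)
  hence "(v \<circ> simple_refl j) ` {1..i} = {1..i}" by (rule snoc.IH)
  moreover have "simple_refl j ` {1..i} = {1..i}"
    using snoc.prems by (intro simple_refl_image) (auto simp: is_word_snoc)
  ultimately show ?case by (metis image_comp)
qed

lemma reduced_word_avoids:
  "reduced_word n v xs \<Longrightarrow> v ` {1..i} = {1..i} \<Longrightarrow> i \<notin> set xs"
proof (induction xs arbitrary: v rule: rev_induct)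
  case (snoc j xs)
  hence j: "j \<in> {1..<n}" "v (Suc j) < v j" "reduced_word n (v \<circ> simple_refl j) xs"
    by (auto simp: reduced_word_snoc)
  have "inj v"
    using snoc.prems(1) is_word_permutes permutes_inj reduced_word_def by blast
  have "v (Suc j) \<in> {1..n}"
    using snoc.prems(1) is_word_permutes reduced_word_def permutes_in_image[of v "{1..n}" "Suc j"]
      j(1) by auto
  have "j \<noteq> i"
  proof
    assume "j = i"
    hence "v i \<in> {1..i}" using snoc.prems(2) j by auto
    hence "v (Suc i) \<in> {1..i}"
      using j \<open>j = i\<close> \<open>v (Suc j) \<in> {1..n}\<close> by auto
    then obtain k where "k \<in> {1..i}" "v k = v (Suc i)"
      using snoc.prems(2) by (metis imageE)
    thus False using injD[OF \<open>inj v\<close>, of k "Suc i"] by simp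
  qed
  moreover have "(v \<circ> simple_refl j) ` {1..i} = {1..i}"
    using simple_refl_image[OF \<open>j \<noteq> i\<close>] j(1) snoc.prems(2)
    by (metis atLeastLessThan_iff image_comp)
  ultimately show ?case using snoc.IH[OF j(3)] by auto
qed auto

lemma support_iff:
  assumes "v permutes {1..n}"
  shows "i \<in> support n v \<longleftrightarrow> v ` {1..i} \<noteq> {1..i}"
proof -
  obtain xs where xs: "reduced_word n v xs" using exists_reduced_word[OF assms] by blast
  show ?thesis
  proof
    assume "i \<in> support n v"
    then obtain ys where "reduced_word n v ys" "i \<in> set ys" by (auto simp: support_def)
    thus "v ` {1..i} \<noteq> {1..i}" using reduced_word_avoids[of n v ys i] by blast
  next
    assume "v ` {1..i} \<noteq> {1..i}"
    hence "i \<in> set xs" using word_avoids_image[of n v xs i] xs by (auto simp: reduced_word_def)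
    thus "i \<in> support n v" using xs by (auto simp: support_def)
  qed
qed


section \<open>Full commutativity is 321-avoidance\<close>

definition avoids_321 :: "nat \<Rightarrow> (nat \<Rightarrow> nat) \<Rightarrow> bool" where
  "avoids_321 n v \<longleftrightarrow> \<not> (\<exists>a b c. 1 \<le> a \<and> a < b \<and> b < c \<and> c \<le> n \<and> v a > v b \<and> v b > v c)"

lemma commutation_move_mset: "commutation_move\<^sup>*\<^sup>* xs ys \<Longrightarrow> mset xs = mset ys"
  by (induction rule: rtranclp_induct) (auto elim!: commutation_move.cases)

lemma commutation_move_snoc:
  "commutation_move\<^sup>*\<^sup>* xs ys \<Longrightarrow> commutation_move\<^sup>*\<^sup>* (xs @ zs) (ys @ zs)"
proof (induction rule: rtranclp_induct)
  case (step y z)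
  have "commutation_move (y @ zs) (z @ zs)"
    using step(2) by cases (metis append.assoc commutation_move.intros)
  thus ?case using step by auto
qed auto

lemma braid:
  "simple_refl i \<circ> simple_refl (Suc i) \<circ> simple_refl i =
   simple_refl (Suc i) \<circ> simple_refl i \<circ> simple_refl (Suc i)"
  by (rule ext) (auto simp: simple_refl_eq)

lemma consecutive_321:
  assumes "v permutes {1..n}" "1 \<le> a" "a + 2 \<le> n" "v a > v (a + 1)" "v (a + 1) > v (a + 2)"
  shows "\<exists>xs. reduced_word n v (xs @ [a, Suc a, a]) \<and> reduced_word n v (xs @ [Suc a, a, Suc a])"
proof -
  define u where "u = v \<circ> simple_refl a \<circ> simple_refl (Suc a) \<circ> simple_refl a"
  have u': "u = v \<circ> simple_refl (Suc a) \<circ> simple_refl a \<circ> simple_refl (Suc a)"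
    unfolding u_def using braid by (simp add: comp_assoc)
  have "u permutes {1..n}"
    unfolding u_def using assms by (intro permutes_comp_simple_refl) auto
  then obtain xs where xs: "reduced_word n u xs" using exists_reduced_word by blast
  have "reduced_word n v (((xs @ [a]) @ [Suc a]) @ [a])"
    using xs assms unfolding reduced_word_snoc u_def by (auto simp: simple_refl_eq)
  moreover have "reduced_word n v (((xs @ [Suc a]) @ [a]) @ [Suc a])"
    using xs assms unfolding reduced_word_snoc u' by (auto simp: simple_refl_eq)
  ultimately show ?thesis by auto
qed

lemma contains_321_words:
  assumes "v permutes {1..n}" "1 \<le> a" "a < b" "b < c" "c \<le> n" "v a > v b" "v b > v c"
  shows "\<exists>xs ys. reduced_word n v xs \<and> reduced_word n v ys \<and> mset xs \<noteq> mset ys"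
  using assms
proof (induction "card (inversions n v) + (c - a)" arbitrary: v a b c rule: less_induct)
  case less
  have swap: ?case
    if sw: "i \<in> {1..<n}" "v (Suc i) < v i"
      "\<exists>a' b' c'. 1 \<le> a' \<and> a' < b' \<and> b' < c' \<and> c' \<le> n \<and> c' - a' \<le> c - a \<and>
        (v \<circ> simple_refl i) a' > (v \<circ> simple_refl i) b' \<and>
        (v \<circ> simple_refl i) b' > (v \<circ> simple_refl i) c'" for i
  proof -
    obtain a' b' c' where abc: "1 \<le> a'" "a' < b'" "b' < c'" "c' \<le> n" "c' - a' \<le> c - a"
      "(v \<circ> simple_refl i) a' > (v \<circ> simple_refl i) b'"
      "(v \<circ> simple_refl i) b' > (v \<circ> simple_refl i) c'"
      using sw(3) by blast
    have "card (inversions n (v \<circ> simple_refl i)) + (c' - a') < card (inversions n v) + (c - a)"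
      using abc(5) card_inversions_desc[OF sw(1,2)] by linarith
    from less.hyps[OF this permutes_comp_simple_refl[OF less.prems(1) sw(1)] abc(1-4,6,7)]
    obtain xs ys where "reduced_word n (v \<circ> simple_refl i) xs"
      "reduced_word n (v \<circ> simple_refl i) ys" "mset xs \<noteq> mset ys" by blast
    hence "reduced_word n v (xs @ [i])" "reduced_word n v (ys @ [i])"
      "mset (xs @ [i]) \<noteq> mset (ys @ [i])"
      using sw by (auto simp: reduced_word_snoc)
    thus ?thesis by blast
  qed
  note neq = permutes_neq[OF less.prems(1)]
  consider "a + 1 < b" "v (a + 1) > v b" | "a + 1 < b" "v (a + 1) < v b"
    | "b + 1 < c" "v (c - 1) < v b" | "b + 1 < c" "v (c - 1) > v b" | "b = a + 1" "c = a + 2"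
    using less.prems(3,4) neq[of "a + 1" b] neq[of "c - 1" b] by linarith
  then show ?case
  proof cases
    case 1
    have "card (inversions n v) + (c - (a + 1)) < card (inversions n v) + (c - a)"
      using less.prems by linarith
    from less.hyps[OF this less.prems(1) _ 1(1) less.prems(4,5) 1(2) less.prems(7)]
    show ?thesis by simp
  next
    case 2
    let ?u = "v \<circ> simple_refl a"
    have pat: "1 \<le> (a + 1) \<and> (a + 1) < b \<and> b < c \<and> c \<le> n \<and> c - (a + 1) \<le> c - a \<and>
        ?u (a + 1) > ?u b \<and> ?u b > ?u c"
      using less.prems 2 by (auto simp: simple_refl_eq)
    show ?thesis
    proof (rule swap[of "a"])
      show "a \<in> {1..<n}" "v (Suc a) < v a" using less.prems 2 by auto
    qed (use pat in blast)
  next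
    case 3
    have "card (inversions n v) + (c - 1 - a) < card (inversions n v) + (c - a)"
      "b < c - 1" "c - 1 \<le> n"
      using less.prems 3 by linarith+
    from less.hyps[OF this(1) less.prems(1-3) this(2,3) less.prems(6) 3(2)]
    show ?thesis by simp
  next
    case 4
    let ?u = "v \<circ> simple_refl (c - 1)"
    have pat: "1 \<le> a \<and> a < b \<and> b < (c - 1) \<and> (c - 1) \<le> n \<and> (c - 1) - a \<le> c - a \<and>
        ?u a > ?u b \<and> ?u b > ?u (c - 1)"
      using less.prems 4 by (auto simp: simple_refl_eq)
    show ?thesis
    proof (rule swap[of "(c - 1)"])
      show "(c - 1) \<in> {1..<n}" "v (Suc (c - 1)) < v (c - 1)" using less.prems 4 by auto
    qed (use pat in blast)
  next
    case 5
    obtain xs where "reduced_word n v (xs @ [a, Suc a, a])"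
      "reduced_word n v (xs @ [Suc a, a, Suc a])"
      using consecutive_321[OF less.prems(1,2)] less.prems(5-7) 5 by auto
    moreover have "mset (xs @ [a, Suc a, a]) \<noteq> mset (xs @ [Suc a, a, Suc a])"
      by (auto simp: multiset_eq_iff)
    ultimately show ?thesis by blast
  qed
qed

lemma avoids_321_desc:
  assumes "avoids_321 n v" "i \<in> {1..<n}" "v (Suc i) < v i"
  shows "avoids_321 n (v \<circ> simple_refl i)"
  unfolding avoids_321_def
proof clarify
  fix a b c
  assume *: "1 \<le> a" "a < b" "b < c" "c \<le> n"
    "(v \<circ> simple_refl i) b < (v \<circ> simple_refl i) a" "(v \<circ> simple_refl i) c < (v \<circ> simple_refl i) b"
  let ?s = "simple_refl i"
  have "?s a < ?s b" "?s b < ?s c" "1 \<le> ?s a" "?s c \<le> n"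
    using * assms(2,3) by (auto simp: simple_refl_eq split: if_splits)
  thus False using assms(1) *(5,6) unfolding avoids_321_def by auto
qed

lemma avoids_321_words:
  assumes "avoids_321 n v" "reduced_word n v xs" "reduced_word n v ys"
  shows "commutation_move\<^sup>*\<^sup>* xs ys"
  using assms
proof (induction "length xs" arbitrary: v xs ys rule: less_induct)
  case less
  have len: "length xs = length ys" using less.prems by (simp add: reduced_word_def)
  show ?case
  proof (cases xs rule: rev_cases)
    case Nil
    then show ?thesis using len by auto
  next
    case (snoc xs' i)
    then obtain ys' j where ys: "ys = ys' @ [j]" using len by (cases ys rule: rev_cases) auto
    have i: "i \<in> {1..<n}" "v (Suc i) < v i" "reduced_word n (v \<circ> simple_refl i) xs'"
      and j: "j \<in> {1..<n}" "v (Suc j) < v j" "reduced_word n (v \<circ> simple_refl j) ys'"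
      using less.prems unfolding snoc ys reduced_word_snoc by auto
    have av: "avoids_321 n (v \<circ> simple_refl i)" "avoids_321 n (v \<circ> simple_refl j)"
      using avoids_321_desc less.prems(1) i j by auto
    have lt: "length xs' < length xs" "length ys' < length xs"
      using len by (auto simp: snoc ys)
    show ?thesis
    proof (cases "i = j")
      case True
      hence "commutation_move\<^sup>*\<^sup>* xs' ys'"
        using less.hyps[OF lt(1) av(1) i(3)] j(3) by simp
      thus ?thesis using commutation_move_snoc True snoc ys by auto
    next
      case False
      have consec: "\<not> (1 \<le> k \<and> Suc (Suc k) \<le> n \<and> v (Suc k) < v k \<and> v (Suc (Suc k)) < v (Suc k))"
        for k
        using less.prems(1) unfolding avoids_321_def by (metis lessI)
      have "j \<noteq> Suc i"
        using consec[of i] i(1,2) j(1,2) by auto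
      moreover have "i \<noteq> Suc j"
        using consec[of j] i(1,2) j(1,2) by auto
      ultimately have far: "i + 1 < j \<or> j + 1 < i" using False by linarith
      have comm: "v \<circ> simple_refl i \<circ> simple_refl j = v \<circ> simple_refl j \<circ> simple_refl i"
        using far by (intro ext) (auto simp: simple_refl_eq)
      have "v permutes {1..n}"
        using less.prems(2) is_word_permutes reduced_word_def by blast
      hence "v \<circ> simple_refl i \<circ> simple_refl j permutes {1..n}"
        using i j by (intro permutes_comp_simple_refl) auto
      then obtain zs where zs: "reduced_word n (v \<circ> simple_refl i \<circ> simple_refl j) zs"
        using exists_reduced_word by blast
      have "reduced_word n (v \<circ> simple_refl i) (zs @ [j])"
        "reduced_word n (v \<circ> simple_refl j) (zs @ [i])"
        using zs i j far unfolding reduced_word_snoc by (auto simp: simple_refl_eq comm)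
      hence "commutation_move\<^sup>*\<^sup>* xs' (zs @ [j])" "commutation_move\<^sup>*\<^sup>* (zs @ [i]) ys'"
        using less.hyps[OF lt(1) av(1) i(3)] less.hyps[OF _ av(2) _ j(3)] lt(2) j(3)
        by (auto simp: reduced_word_def)
      hence "commutation_move\<^sup>*\<^sup>* xs (zs @ [j, i])" "commutation_move\<^sup>*\<^sup>* (zs @ [i, j]) ys"
        using commutation_move_snoc[of xs' "zs @ [j]" "[i]"]
          commutation_move_snoc[of "zs @ [i]" ys' "[j]"] snoc ys by auto
      moreover have "commutation_move (zs @ [j, i]) (zs @ [i, j])"
        using commutation_move.intros[of j i zs "[]"] far by auto
      ultimately show ?thesis by (meson converse_rtranclp_into_rtranclp rtranclp_trans)
    qed
  qed
qed

lemma fully_commutative_iff: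
  assumes "v permutes {1..n}"
  shows "fully_commutative n v \<longleftrightarrow> avoids_321 n v"
proof
  show "fully_commutative n v \<Longrightarrow> avoids_321 n v"
    using contains_321_words[OF assms] commutation_move_mset
    unfolding fully_commutative_def avoids_321_def by meson
  show "avoids_321 n v \<Longrightarrow> fully_commutative n v"
    using avoids_321_words unfolding fully_commutative_def by blast
qed

end

theory Submission
  imports Defs "HOL-Library.Sublist"
begin

text \<open>
  Write the one-line notations as \<open>v = us a b zs\<close> and \<open>w = us b a zs\<close> with \<open>a < b\<close>. Avoidance of 321
  makes \<open>b\<close> larger than all of \<open>us\<close> and \<open>a\<close> smaller than all of \<open>zs\<close>, and \<open>i \<in> supp v\<close> yields
  \<open>c\<close> in \<open>us\<close> and \<open>e\<close> in \<open>zs\<close> with \<open>e < c\<close>. If \<open>a\<close> bumps an entry of the first row of \<open>P(us)\<close>, the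
  two insertions agree from then on. Otherwise all entries of \<open>us\<close> above \<open>a\<close>, in particular \<open>c\<close>, lie
  in the second row, and after \<open>a\<close> and \<open>b\<close> the tableaux differ only in the row containing \<open>b\<close>.
  As long as they differ while \<open>zs\<close> is inserted, they differ in the row of a single entry \<open>d\<close>, and the
  second row of \<open>P(w)\<close> has at least two more entries in \<open>[c, d]\<close> than the first row; inserting \<open>e\<close>
  raises this excess to three, which makes \<open>[c, d]\<close> crowded.
\<close>

section \<open>Words avoiding 321\<close>

definition word_avoids_321 :: "nat list \<Rightarrow> bool" where
  "word_avoids_321 xs \<longleftrightarrow> \<not> (\<exists>f g h. subseq [f, g, h] xs \<and> g < f \<and> h < g)"

lemma word_avoids_321_subseq:
  assumes "word_avoids_321 ys" "subseq xs ys"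
  shows "word_avoids_321 xs"
  unfolding word_avoids_321_def
proof clarify
  fix f g h assume "subseq [f, g, h] xs" "g < f" "h < g"
  moreover from this assms(2) have "subseq [f, g, h] ys"
    using subseq_order.order_trans by blast
  ultimately show False
    using assms(1) unfolding word_avoids_321_def by metis
qed

lemma word_avoids_321_appendD: "word_avoids_321 (xs @ ys) \<Longrightarrow> word_avoids_321 xs"
  by (rule word_avoids_321_subseq) (auto intro: subseq_rev_drop_many)

lemma subseq_snoc_pair: "f \<in> set xs \<Longrightarrow> subseq [f, g] (xs @ [g])"
  using list_emb_append_mono[of "(=)" "[f]" xs "[g]" "[g]"] by (simp add: subseq_singleton_left)

section \<open>Row insertion on sets of entries\<close>

text \<open>A row increases strictly, so its set of entries determines it. A bumped entry just joins
  \<open>B\<close> and bumps nothing itself; \<open>tableau_insert_two_row\<close> gives conditions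
  under which this is true row insertion.\<close>

definition set_insert :: "nat \<Rightarrow> nat set \<times> nat set \<Rightarrow> nat set \<times> nat set" where
  "set_insert x = (\<lambda>(A, B).
     if \<exists>y\<in>A. x < y
     then let y = Min {y \<in> A. x < y} in (insert x (A - {y}), insert y B)
     else (insert x A, B))"

lemma set_insert_append:
  "(\<And>y. y \<in> A \<Longrightarrow> y \<le> x) \<Longrightarrow> set_insert x (A, B) = (insert x A, B)"
  by (force simp: set_insert_def)

lemma set_insert_bump:
  assumes "finite A" "y \<in> A" "x < y" "\<And>z. z \<in> A \<Longrightarrow> x < z \<Longrightarrow> y \<le> z"
  shows "set_insert x (A, B) = (insert x (A - {y}), insert y B)"
proof -
  have "Min {y \<in> A. x < y} = y"
    using assms by (intro Min_eqI) auto
  then show ?thesis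
    using assms by (auto simp: set_insert_def Let_def)
qed

lemma set_insert_cases [consumes 1, case_names app bump]:
  fixes A :: "nat set"
  assumes "finite A"
  obtains (app) "\<And>y. y \<in> A \<Longrightarrow> y \<le> x" "set_insert x (A, B) = (insert x A, B)"
  | (bump) y where "y \<in> A" "x < y" "\<And>z. z \<in> A \<Longrightarrow> x < z \<Longrightarrow> y \<le> z"
      "set_insert x (A, B) = (insert x (A - {y}), insert y B)"
proof (cases "\<exists>y\<in>A. x < y")
  case True
  define y where "y = Min {y \<in> A. x < y}"
  have "y \<in> {y \<in> A. x < y}"
    unfolding y_def using assms True by (intro Min_in) auto
  moreover have "y \<le> z" if "z \<in> A" "x < z" for z
    unfolding y_def using assms that by simp
  ultimately show ?thesis
    using bump[of y] set_insert_bump[OF assms, of y x B] by auto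
next
  case False
  then show ?thesis
    using app set_insert_append[of A x B] by (meson not_le_imp_less)
qed

section \<open>Tableaux with at most two rows\<close>

text \<open>\<open>tableau_insert\<close> starts from \<open>[]\<close> and creates no empty rows,
  hence the \<open>filter\<close>.\<close>

definition two_row_tableau :: "nat set \<times> nat set \<Rightarrow> nat list list" where
  "two_row_tableau = (\<lambda>(A, B).
     filter (\<lambda>r. r \<noteq> []) [sorted_list_of_set A, sorted_list_of_set B])"

lemma Row2_two_row_tableau:
  "finite A \<Longrightarrow> finite B \<Longrightarrow> A = {} \<longrightarrow> B = {} \<Longrightarrow> Row2 (two_row_tableau (A, B)) = B"
  by (auto simp: two_row_tableau_def Row2_def)

lemma row_insert_append:
  "(\<And>y. y \<in> set r \<Longrightarrow> y < x) \<Longrightarrow> row_insert x r = (r @ [x], None)"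
  by (induction r) (auto dest: less_asym)

lemma row_insert_bump:
  "(\<And>z. z \<in> set l \<Longrightarrow> z < x) \<Longrightarrow> x < y \<Longrightarrow>
   row_insert x (l @ y # s) = (l @ x # s, Some y)"
  by (induction l) (auto dest: less_asym)

lemma row_insert_sorted_append:
  assumes "finite A" "\<And>y. y \<in> A \<Longrightarrow> y < x"
  shows "row_insert x (sorted_list_of_set A) = (sorted_list_of_set (insert x A), None)"
proof -
  have "sorted_list_of_set (insert x A) = sorted_list_of_set A @ [x]"
    using assms by (intro sorted_list_of_set_unique[THEN iffD1])
      (auto simp: sorted_wrt_append card_insert_if)
  then show ?thesis
    using assms row_insert_append[of "sorted_list_of_set A" x] by (metis set_sorted_list_of_set)
qed

lemma row_insert_sorted_bump:
  assumes "finite A" "x \<notin> A" "y \<in> A" "x < y" "\<And>z. z \<in> A \<Longrightarrow> x < z \<Longrightarrow> y \<le> z"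
  shows "row_insert x (sorted_list_of_set A) =
           (sorted_list_of_set (insert x (A - {y})), Some y)"
proof -
  obtain l s where ls: "sorted_list_of_set A = l @ y # s"
    using assms by (metis set_sorted_list_of_set split_list)
  have A: "A = set (l @ y # s)"
    using assms(1) ls by (metis set_sorted_list_of_set)
  have sorted: "sorted_wrt (<) (l @ y # s)"
    using ls strict_sorted_list_of_set by metis
  have l: "z < x" if "z \<in> set l" for z
  proof -
    have "z < y" "z \<in> A" using sorted that A by (auto simp: sorted_wrt_append)
    then show ?thesis using assms(2,5) by (metis linorder_neqE_nat not_le)
  qed
  have s: "y < z" if "z \<in> set s" for z
    using sorted that by (auto simp: sorted_wrt_append)
  have "sorted_wrt (<) (l @ x # s)"
    using sorted l s \<open>x < y\<close> by (fastforce simp: sorted_wrt_append)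
  moreover have "set (l @ x # s) = insert x (A - {y})"
    using sorted unfolding A by (auto simp: sorted_wrt_append)
  ultimately have "sorted_list_of_set (insert x (A - {y})) = l @ x # s"
    by (metis sorted_list_of_set.idem_if_sorted_distinct strict_sorted_iff)
  then show ?thesis
    using row_insert_bump[of l x y s] l \<open>x < y\<close> ls by simp
qed

text \<open>The last hypothesis makes a bumped entry larger than all of \<open>B\<close>, so it is
  appended to the second row and nothing reaches a third.\<close>

lemma tableau_insert_two_row:
  assumes "finite A" "finite B" "A = {} \<longrightarrow> B = {}" "x \<notin> A"
    and "\<And>y f. y \<in> A \<Longrightarrow> f \<in> B \<Longrightarrow> x < y \<Longrightarrow> f < y"
  shows "tableau_insert x (two_row_tableau (A, B)) = two_row_tableau (set_insert x (A, B))"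
  using \<open>finite A\<close>
proof (cases rule: set_insert_cases[of _ x B])
  case app
  then have "row_insert x (sorted_list_of_set A) = (sorted_list_of_set (insert x A), None)"
    using assms by (intro row_insert_sorted_append) (auto simp: le_less)
  with app(2) show ?thesis
    using assms(1-3) by (auto simp: two_row_tableau_def)
next
  case (bump y)
  have "row_insert x (sorted_list_of_set A) =
          (sorted_list_of_set (insert x (A - {y})), Some y)"
    using assms bump by (intro row_insert_sorted_bump) auto
  moreover have "row_insert y (sorted_list_of_set B) = (sorted_list_of_set (insert y B), None)"
    using assms bump by (intro row_insert_sorted_append) auto
  moreover have "sorted_list_of_set A \<noteq> []" "sorted_list_of_set (insert x (A - {y})) \<noteq> []"
    "sorted_list_of_set (insert y B) \<noteq> []"
    using assms(1,2) bump(1) by auto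
  ultimately show ?thesis
    using bump(4) by (auto simp: two_row_tableau_def)
qed

text \<open>
  The last conclusion keeps the insertion within two rows: in a word avoiding 321, every later
  letter exceeds the smaller entry of each earlier inversion, hence cannot bump an entry of the
  first row that lies below some entry of the second row.
\<close>

lemma insertion_two_row:
  assumes "distinct p" "word_avoids_321 p" "fold set_insert p ({}, {}) = (A, B)"
  shows "fold tableau_insert p [] = two_row_tableau (A, B) \<and> finite A \<and> finite B \<and>
    A \<union> B = set p \<and> A \<inter> B = {} \<and> (A = {} \<longrightarrow> B = {}) \<and>
    (\<forall>y\<in>A. \<forall>f\<in>B. y < f \<longrightarrow> (\<exists>f' g. subseq [f', g] p \<and> g < f' \<and> y \<le> g))"
  using assms
proof (induction p arbitrary: A B rule: rev_induct)
  case Nil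
  then show ?case by (simp add: two_row_tableau_def)
next
  case (snoc x p)
  obtain A' B' where AB': "fold set_insert p ({}, {}) = (A', B')" by fastforce
  have "word_avoids_321 p" using snoc.prems(2) by (rule word_avoids_321_appendD)
  with snoc.IH[OF _ _ AB'] snoc.prems(1)
  have tab: "fold tableau_insert p [] = two_row_tableau (A', B')"
    and fin: "finite A'" "finite B'" and un: "A' \<union> B' = set p" and dis: "A' \<inter> B' = {}"
    and emp: "A' = {} \<longrightarrow> B' = {}"
    and inv: "\<And>y f. y \<in> A' \<Longrightarrow> f \<in> B' \<Longrightarrow> y < f \<Longrightarrow>
       \<exists>f' g. subseq [f', g] p \<and> g < f' \<and> y \<le> g"
    by auto
  have x: "x \<notin> set p" using snoc.prems(1) by simp
  have AB: "set_insert x (A', B') = (A, B)" using snoc.prems(3) AB' by simp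
  \<comment> \<open>Otherwise \<open>f\<close> above \<open>y\<close> provides an inversion
    \<open>f'\<close>, \<open>g\<close> with \<open>y \<le> g\<close>, and \<open>x < y\<close>
    completes it to a 321 pattern.\<close>
  have no_bump: "f < y" if "y \<in> A'" "f \<in> B'" "x < y" for y f
  proof (rule ccontr)
    assume "\<not> f < y"
    then have "y < f" using dis that by (metis disjoint_iff linorder_neqE_nat)
    then obtain f' g where g: "subseq [f', g] p" "g < f'" "y \<le> g"
      using inv \<open>y \<in> A'\<close> \<open>f \<in> B'\<close> by metis
    then have "subseq [f', g, x] (p @ [x])" using list_emb_append_mono[of "(=)" "[f', g]" p "[x]" "[x]"] by simp
    then show False
      using snoc.prems(2) g that unfolding word_avoids_321_def by (meson less_le_trans)
  qed
  have inv_mono: "\<exists>f' g. subseq [f', g] (p @ [x]) \<and> g < f' \<and> y \<le> g"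
    if "y \<in> A'" "f \<in> B'" "y < f" for y f
    using inv[OF that] by (meson subseq_rev_drop_many)
  \<comment> \<open>The new letter \<open>x\<close> itself serves as \<open>g\<close>, after the
    earlier and larger letter \<open>f\<close>.\<close>
  have inv_new: "\<exists>f' g. subseq [f', g] (p @ [x]) \<and> g < f' \<and> y \<le> g"
    if "f \<in> set p" "x < f" "y \<le> x" for y f
    using subseq_snoc_pair[OF that(1), of x] that by blast
  have "fold tableau_insert (p @ [x]) [] = two_row_tableau (A, B)"
    using tableau_insert_two_row[OF fin emp, of x] no_bump x un tab AB by auto
  moreover have "\<exists>f' g. subseq [f', g] (p @ [x]) \<and> g < f' \<and> y \<le> g"
    if yf: "y \<in> A" "f \<in> B" "y < f" for y f
    using fin(1)
  proof (cases rule: set_insert_cases[of _ x B'])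
    case app
    then have "A = insert x A'" "B = B'" using AB by auto
    then consider "y = x" "f \<in> B'" | "y \<in> A'" "f \<in> B'" using yf by auto
    then show ?thesis
    proof cases
      case 1
      then show ?thesis using inv_new[of f y] yf un by auto
    qed (use inv_mono yf in blast)
  next
    case (bump z)
    then have "A = insert x (A' - {z})" "B = insert z B'" using AB by auto
    then consider "y = x" | "y \<in> A'" "y \<noteq> z" "f = z" | "y \<in> A'" "f \<in> B'" using yf by auto
    then show ?thesis
    proof cases
      case 1
      then show ?thesis
        using inv_new[of f y] yf \<open>B = insert z B'\<close> bump(1) un by auto
    next
      case 2
      \<comment> \<open>As \<open>z\<close> is the least entry of \<open>A'\<close> above
        \<open>x\<close>, the entry \<open>y < z\<close> is at most \<open>x\<close>, and
        \<open>z\<close>, \<open>x\<close> form the inversion.\<close>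
      then have "y \<le> x" using bump(3)[of y] yf by (metis not_le)
      then show ?thesis using inv_new[of z y] bump un by auto
    qed (use inv_mono yf in blast)
  qed
  moreover have "finite A \<and> finite B \<and> A \<union> B = set (p @ [x]) \<and> A \<inter> B = {} \<and> A \<noteq> {}"
    using fin(1)
  proof (cases rule: set_insert_cases[of _ x B'])
    case app
    then show ?thesis using AB fin un dis x by auto
  next
    case (bump z)
    then show ?thesis using AB fin un dis x by auto
  qed
  ultimately show ?case by blast
qed

section \<open>Comparing the two insertions letter by letter\<close>

text \<open>
  The invariant of the comparison of the two insertions: the states differ only by one entry
  \<open>d\<close>, which sits in the first row for \<open>v\<close> and in the second row for \<open>w\<close>. Inserting a letter
  \<open>x < d\<close> bumps \<open>d\<close> for \<open>v\<close> and the least entry of \<open>Y\<close> for \<open>w\<close>; that entry becomes the new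
  \<open>d\<close>. The excess of the second row over the first on \<open>[c, d]\<close> never drops, and it grows
  whenever \<open>x < c\<close>.
\<close>

inductive differ_at ::
  "nat \<Rightarrow> nat \<Rightarrow> nat list \<Rightarrow> nat set \<times> nat set \<Rightarrow> nat set \<times> nat set \<Rightarrow> bool" for c k zs where
  differ_atI: "differ_at c k zs (X \<union> insert d Y, B) (X \<union> Y, insert d B)"
  if "finite X" "finite Y" "finite B" "c \<le> d"
    "\<And>x. x \<in> X \<Longrightarrow> x < d" "\<And>y. y \<in> Y \<Longrightarrow> d < y" "\<And>x z. x \<in> X \<Longrightarrow> z \<in> set zs \<Longrightarrow> x < z"
    "\<And>y. y \<in> insert d Y \<Longrightarrow> y \<notin> set zs \<and> word_avoids_321 (y # zs)"
    "card (X \<inter> {c..}) + k \<le> card (insert d B \<inter> {c..d})"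

lemma word_avoids_321_ConsD:
  assumes "word_avoids_321 (d # x # zs)" "x < d" "z \<in> set zs"
  shows "x \<le> z"
proof -
  have "subseq [d, x, z] (d # x # zs)"
    using assms(3) by (simp add: subseq_singleton_left)
  then show ?thesis
    using assms(1,2) unfolding word_avoids_321_def by (meson not_le)
qed

text \<open>If \<open>x < d\<close> and \<open>Y\<close> is empty, \<open>d\<close> is bumped in
  \<open>sv\<close> while \<open>x\<close> is appended in \<open>sw\<close>, and the states meet. If
  \<open>d < x\<close>, then \<open>X\<close> and \<open>d\<close> lie below \<open>x\<close>, so
  \<open>Y\<close> alone decides what happens and both states change alike; a bumped entry exceeds
  \<open>d\<close> and does not count in \<open>[c, d]\<close>.\<close>

lemma set_insert_differ_at:
  assumes "differ_at c k (x # zs) sv sw" "distinct (x # zs)"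
  shows "set_insert x sv = set_insert x sw \<or>
    differ_at c (k + of_bool (x < c)) zs (set_insert x sv) (set_insert x sw)"
  using assms(1)
proof cases
  case (differ_atI X Y B d)
  note sv = differ_atI(1) and sw = differ_atI(2) and fin = differ_atI(3-5) and cd = differ_atI(6)
    and Xd = differ_atI(7) and Yd = differ_atI(8) and Xz = differ_atI(9) and Yz = differ_atI(10)
    and card = differ_atI(11)
  have x: "x \<notin> insert d Y" "x \<notin> X" "x \<notin> set zs"
    using Yz Xz[of x x] assms(2) by auto
  have Yz': "y \<notin> set zs \<and> word_avoids_321 (y # zs)" if "y \<in> insert d Y" for y
    using Yz[OF that] word_avoids_321_subseq[of "y # x # zs" "y # zs"] by auto
  have xz: "x \<notin> set zs \<and> word_avoids_321 (x # zs)"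
    using Yz[of d] x word_avoids_321_subseq[of "d # x # zs" "x # zs"] by auto
  show ?thesis
  proof (cases "x < d")
    case True
    have v: "set_insert x sv = (insert x (X \<union> Y), insert d B)"
    proof -
      have "set_insert x (X \<union> insert d Y, B) =
          (insert x (X \<union> insert d Y - {d}), insert d B)"
        using fin True Xz Yd by (intro set_insert_bump) (auto dest: less_asym less_imp_le)
      moreover have "X \<union> insert d Y - {d} = X \<union> Y" using Xd Yd by blast
      ultimately show ?thesis using sv by simp
    qed
    show ?thesis
    proof (cases "Y = {}")
      case Y: True
      have "set_insert x sw = (insert x (X \<union> Y), insert d B)"
        unfolding sw using Xz Y by (intro set_insert_append) (auto intro: less_imp_le)
      then show ?thesis using v by simp
    next
      case False
      define y where "y = Min Y"
      have y: "y \<in> Y" "\<And>z. z \<in> Y \<Longrightarrow> y \<le> z" using False fin unfolding y_def by auto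
      have dy: "d < y" using Yd y by blast
      have w: "set_insert x sw = (insert x X \<union> (Y - {y}), insert y (insert d B))"
      proof -
        have "set_insert x (X \<union> Y, insert d B) =
            (insert x (X \<union> Y - {y}), insert y (insert d B))"
          using fin True Xz y dy by (intro set_insert_bump) (auto dest: less_asym)
        moreover have "X - {y} = X" using Xd dy by (auto dest: less_asym)
        ultimately show ?thesis using sw by (simp add: Un_Diff)
      qed
      have v': "set_insert x sv = (insert x X \<union> insert y (Y - {y}), insert d B)"
        using v y by auto
      \<comment> \<open>A letter \<open>x < c\<close> leaves the first-row count unchanged, so the
        second row's gain of \<open>y\<close> is then a net gain.\<close>
      have "card (insert x X \<inter> {c..}) + of_bool (x < c) \<le> card (X \<inter> {c..}) + 1"
        using fin by (cases "x < c") (auto simp: Int_insert_left card_insert_if)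
      moreover have "card (insert d B \<inter> {c..d}) + 1 \<le> card (insert y (insert d B) \<inter> {c..y})"
      proof -
        have "card (insert y (insert d B \<inter> {c..d})) = card (insert d B \<inter> {c..d}) + 1"
          using fin dy by simp
        moreover have "insert y (insert d B \<inter> {c..d}) \<subseteq> insert y (insert d B) \<inter> {c..y}"
          using dy cd by auto
        ultimately show ?thesis
          using fin by (metis card_mono finite_Int finite_insert)
      qed
      ultimately have card': "card (insert x X \<inter> {c..}) + (k + of_bool (x < c)) \<le>
          card (insert y (insert d B) \<inter> {c..y})"
        using card by linarith
      \<comment> \<open>After \<open>d\<close> and \<open>x < d\<close>, a later letter below
        \<open>x\<close> would complete a 321 pattern; hence \<open>x\<close> may join
        \<open>X\<close>.\<close>
      have xzs: "x < z" if "z \<in> set zs" for z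
        using word_avoids_321_ConsD[of d x zs z] Yz[of d] True that x(3)
        by (metis insertI1 le_neq_implies_less)
      have Xy: "z < y" if "z \<in> insert x X" for z
        using that True Xd[of z] dy by auto
      have yY: "y < z" if "z \<in> Y - {y}" for z
        using that y(2)[of z] by auto
      have "differ_at c (k + of_bool (x < c)) zs (set_insert x sv) (set_insert x sw)"
        unfolding v' w
        by (rule differ_at.differ_atI) (use fin cd dy Xy yY xzs Xz Yz' y card' in auto)
      then show ?thesis ..
    qed
  next
    case False
    then have dx: "d < x" using x by auto
    then have k: "k + of_bool (x < c) = k" using cd by simp
    have Xx: "y < x" if "y \<in> X" for y using Xz that by simp
    show ?thesis using fin(2)
    proof (cases rule: set_insert_cases[of _ x B])
      case app
      have v: "set_insert x sv = (X \<union> insert d (insert x Y), B)"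
        unfolding sv using app(1) dx Xx
        by (subst set_insert_append) (auto intro: less_imp_le)
      have w: "set_insert x sw = (X \<union> insert x Y, insert d B)"
        unfolding sw using app(1) dx Xx
        by (subst set_insert_append) (auto intro: less_imp_le)
      have "differ_at c k zs (set_insert x sv) (set_insert x sw)"
        unfolding v w
        by (intro differ_at.differ_atI) (use fin cd dx Xd Yd Xz Yz' xz card in auto)
      then show ?thesis using k by simp
    next
      case (bump y)
      have v: "set_insert x sv = (X \<union> insert d (insert x (Y - {y})), insert y B)"
        unfolding sv using bump(1-3) dx Xx fin Xd Yd
        by (subst set_insert_bump[of _ y]) (auto dest: less_asym)
      have w: "set_insert x sw = (X \<union> insert x (Y - {y}), insert d (insert y B))"
        unfolding sw using bump(1-3) dx Xx fin Xd Yd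
        by (subst set_insert_bump[of _ y]) (auto dest: less_asym)
      have "insert d (insert y B) \<inter> {c..d} = insert d B \<inter> {c..d}"
        using Yd[OF bump(1)] by auto
      then have "differ_at c k zs (set_insert x sv) (set_insert x sw)"
        unfolding v w
        by (intro differ_at.differ_atI) (use fin cd dx Xd Yd Xz Yz' xz card in auto)
      then show ?thesis using k by simp
    qed
  qed
qed

text \<open>Equal states stay equal, so a difference at the end means a difference throughout, and
  each letter below \<open>c\<close> has then added one to the excess.\<close>

lemma fold_set_insert_differ_at:
  assumes "differ_at c k zs sv sw" "distinct zs"
  shows "fold set_insert zs sv = fold set_insert zs sw \<or>
    differ_at c (k + length (filter (\<lambda>x. x < c) zs)) []
      (fold set_insert zs sv) (fold set_insert zs sw)"
  using assms
proof (induction zs arbitrary: k sv sw)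
  case (Cons x zs)
  from set_insert_differ_at[OF Cons.prems] show ?case
  proof
    assume "differ_at c (k + of_bool (x < c)) zs (set_insert x sv) (set_insert x sw)"
    from Cons.IH[OF this] Cons.prems(2) show ?thesis by (auto split: if_splits)
  qed simp
qed simp

section \<open>The crowded interval\<close>

text \<open>All \<open>d - c + 1\<close> elements of the interval lie in \<open>A\<close> or
  \<open>B\<close>, so at least \<open>(d - c + 4) / 2\<close> of them lie in \<open>B\<close>. With
  \<open>x\<close> half of \<open>d - c\<close> rounded up, this is at least \<open>x + 2\<close>,
  and \<open>[c, c + 2 x]\<close> covers \<open>[c, d]\<close>.\<close>

lemma crowded_intervalI:
  fixes A B :: "nat set"
  assumes "finite A" "finite B" "{c..d} \<subseteq> A \<union> B" "c \<le> d"
    and "card (A \<inter> {c..d}) + 3 \<le> card (B \<inter> {c..d})"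
  shows "crowded (int ` B)"
proof -
  define x where "x = (d - c + 1) div 2"
  have "card {c..d} \<le> card (A \<inter> {c..d} \<union> B \<inter> {c..d})"
    using assms by (intro card_mono) auto
  also have "\<dots> \<le> card (A \<inter> {c..d}) + card (B \<inter> {c..d})"
    by (rule card_Un_le)
  finally have "x + 2 \<le> card (B \<inter> {c..d})"
    using assms(4,5) unfolding x_def by simp
  also have "card (B \<inter> {c..d}) = card (int ` (B \<inter> {c..d}))"
    by (simp add: card_image)
  also have "\<dots> \<le> card ({int c..int c + 2 * int x} \<inter> int ` B)"
    using assms(2,4) unfolding x_def by (intro card_mono) auto
  finally have "int (card ({int c..int c + 2 * int x} \<inter> int ` B)) > int x + 1"
    by simp
  moreover have "card (B \<inter> {c..d}) \<le> card {c..d}"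
    by (intro card_mono) auto
  then have "int x > 0"
    using assms(4,5) unfolding x_def by simp
  ultimately show ?thesis
    unfolding uncrowded_def by (meson not_le)
qed

text \<open>This is the theorem for one-line words; the pair \<open>c\<close>, \<open>e\<close>
  stands in for the support condition.\<close>

lemma crowded_insertion:
  assumes "distinct (us @ [b, a] @ zs)"
    and av: "word_avoids_321 (us @ [b, a] @ zs)" "word_avoids_321 (us @ [a, b] @ zs)"
    and "a < b" "c \<in> set us" "e \<in> set zs" "e < c"
    and neq: "fold tableau_insert (us @ [a, b] @ zs) [] \<noteq> fold tableau_insert (us @ [b, a] @ zs) []"
    and set: "set (us @ [b, a] @ zs) = {1..n}"
  shows "crowded (int ` Row2 (fold tableau_insert (us @ [b, a] @ zs) []))"
proof -
  have no321: "\<not> (subseq [f, g, h] (us @ [b, a] @ zs) \<and> g < f \<and> h < g)" for f g h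
    using av(1) unfolding word_avoids_321_def by blast
  obtain A B where AB: "fold set_insert us ({}, {}) = (A, B)" by fastforce
  have us: "finite A" "finite B" "A \<union> B = set us"
    using insertion_two_row[OF _ _ AB] assms(1) av(1) word_avoids_321_appendD by auto
  have us_b: "f < b" if "f \<in> set us" for f
  proof -
    have "subseq ([f] @ [b, a]) (us @ [b, a] @ zs)"
      using that by (intro list_emb_append_mono) (auto simp: subseq_singleton_left)
    then show ?thesis
      using no321[of f b a] \<open>a < b\<close> assms(1) that by (auto simp: not_less le_less)
  qed
  have zs_a: "a < h" if "h \<in> set zs" for h
  proof -
    have "subseq ([] @ [b, a] @ [h]) (us @ [b, a] @ zs)"
      using that by (intro list_emb_append_mono) (auto simp: subseq_singleton_left)
    then show ?thesis
      using no321[of b a h] \<open>a < b\<close> assms(1) that by (auto simp: not_less le_less)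
  qed
  define sv where "sv = fold set_insert (us @ [a, b]) ({}, {})"
  define sw where "sw = fold set_insert (us @ [b, a]) ({}, {})"
  have "set_insert b (A, B) = (insert b A, B)"
    using us us_b by (intro set_insert_append) (auto intro: less_imp_le)
  then have sw: "sw = set_insert a (insert b A, B)"
    unfolding sw_def by (simp add: AB)
  have sv: "sv = set_insert b (set_insert a (A, B))"
    unfolding sv_def by (simp add: AB)
  obtain Av Bv where ABv: "fold set_insert zs sv = (Av, Bv)" by fastforce
  obtain Aw Bw where ABw: "fold set_insert zs sw = (Aw, Bw)" by fastforce
  have "fold set_insert (us @ [a, b] @ zs) ({}, {}) = (Av, Bv)"
    using ABv unfolding sv_def by simp
  note tab_v = insertion_two_row[OF _ av(2) this]
  have "fold set_insert (us @ [b, a] @ zs) ({}, {}) = (Aw, Bw)"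
    using ABw unfolding sw_def by simp
  note tab_w = insertion_two_row[OF assms(1) av(1) this]
  have final_neq: "fold set_insert zs sv \<noteq> fold set_insert zs sw"
    using neq tab_v tab_w assms(1) ABv ABw by auto
  have A_a: "y < a" if "y \<in> A" for y
    using \<open>finite A\<close>
  proof (cases rule: set_insert_cases[of _ a B])
    case app
    then show ?thesis using that us assms(1) by (auto simp: le_less)
  next
    case (bump y)
    \<comment> \<open>Every entry of \<open>us\<close> is below \<open>b\<close>, so
      \<open>y\<close> remains the least entry above \<open>a\<close> once \<open>b\<close> is
      appended; both orders reach the same state, which \<open>final_neq\<close> excludes.\<close>
    have "sv = (insert b (insert a (A - {y})), insert y B)"
      unfolding sv bump(4) using us us_b \<open>a < b\<close>
      by (intro set_insert_append) (auto intro: less_imp_le)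
    moreover have "sw = (insert a (insert b A - {y}), insert y B)"
      unfolding sw using us us_b \<open>a < b\<close> bump(1-3)
      by (intro set_insert_bump) (auto intro: less_imp_le)
    moreover have "y \<noteq> b" using us us_b bump(1) by blast
    ultimately have "sv = sw" by auto
    then show ?thesis using final_neq by simp
  qed
  have "a < c" using zs_a[OF \<open>e \<in> set zs\<close>] \<open>e < c\<close> by simp
  \<comment> \<open>Here \<open>X = insert a A\<close>, \<open>d = b\<close> and \<open>Y\<close> is
    empty. The initial excess 2 comes from \<open>c\<close> and \<open>b\<close>, both in the second
    row of \<open>sw\<close>, while \<open>X\<close> stays below \<open>c\<close>.\<close>
  have "differ_at c 2 zs sv sw"
  proof -
    have "set_insert a (A, B) = (insert a A, B)"
      using A_a by (intro set_insert_append) (auto intro: less_imp_le)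
    moreover have "set_insert b (insert a A, B) = (insert b (insert a A), B)"
      using A_a \<open>a < b\<close> by (intro set_insert_append) (auto intro: less_imp_le dest: less_trans)
    ultimately have v: "sv = (insert a A \<union> insert b {}, B)"
      using sv by auto
    have "b \<notin> A" using us us_b by blast
    moreover have "set_insert a (insert b A, B) = (insert a (insert b A - {b}), insert b B)"
      using us A_a \<open>a < b\<close> by (intro set_insert_bump) (auto dest: less_asym)
    ultimately have w: "sw = (insert a A \<union> {}, insert b B)"
      using sw by simp
    have "c \<in> B" using us \<open>c \<in> set us\<close> A_a \<open>a < c\<close> by (metis UnE less_asym)
    have "c < b" using us_b \<open>c \<in> set us\<close> by simp
    then have "card {c, b} \<le> card (insert b B \<inter> {c..b})"
      using us \<open>c \<in> B\<close> by (intro card_mono) auto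
    moreover have "insert a A \<inter> {c..} = {}" using A_a \<open>a < c\<close> by force
    ultimately have card: "card (insert a A \<inter> {c..}) + 2 \<le> card (insert b B \<inter> {c..b})"
      using \<open>c < b\<close> by simp
    have "subseq ([] @ [b] @ zs) (us @ [b, a] @ zs)"
      by (intro list_emb_append_mono) auto
    then have "word_avoids_321 (b # zs)"
      using av(1) word_avoids_321_subseq by auto
    moreover have "x < b" "z \<in> set zs \<Longrightarrow> x < z" if "x \<in> insert a A" for x z
      using that A_a[of x] zs_a[of z] \<open>a < b\<close> by auto
    ultimately show ?thesis
      unfolding v w
      by (intro differ_at.differ_atI) (use us card \<open>c < b\<close> assms(1) in auto)
  qed
  from fold_set_insert_differ_at[OF this] final_neq assms(1)
  have "differ_at c (2 + length (filter (\<lambda>x. x < c) zs)) [] (Av, Bv) (Aw, Bw)"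
    using ABv ABw by auto
  then obtain X d Y B' where fin: "Aw = X \<union> Y" "Bw = insert d B'" "c \<le> d"
      "\<forall>y\<in>Y. d < y"
    and card: "card (X \<inter> {c..}) + (2 + length (filter (\<lambda>x. x < c) zs)) \<le> card (Bw \<inter> {c..d})"
    by cases auto
  \<comment> \<open>The letter \<open>e\<close> is among those counted, which lifts the excess to
    3.\<close>
  have "filter (\<lambda>x. x < c) zs \<noteq> []"
    using \<open>e \<in> set zs\<close> \<open>e < c\<close> by (auto simp: filter_empty_conv)
  then have "length (filter (\<lambda>x. x < c) zs) \<ge> 1"
    by (simp add: Suc_le_eq)
  \<comment> \<open>Entries of \<open>Y\<close> exceed \<open>d\<close>, so on \<open>[c, d]\<close>
    the first row consists of entries of \<open>X\<close>.\<close>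
  moreover have "card (Aw \<inter> {c..d}) \<le> card (X \<inter> {c..})"
  proof (rule card_mono)
    show "finite (X \<inter> {c..})" using fin(1) tab_w by simp
    show "Aw \<inter> {c..d} \<subseteq> X \<inter> {c..}" using fin(1,4) by (auto simp: not_le)
  qed
  ultimately have "card (Aw \<inter> {c..d}) + 3 \<le> card (Bw \<inter> {c..d})"
    using card by linarith
  moreover have "c \<in> {1..n}" "d \<in> {1..n}"
    using \<open>c \<in> set us\<close> fin(2) tab_w set by auto
  then have "{c..d} \<subseteq> Aw \<union> Bw"
    using tab_w set by auto
  ultimately have "crowded (int ` Bw)"
    using crowded_intervalI[of Aw Bw c d] tab_w fin(3) by blast
  moreover have "Row2 (fold tableau_insert (us @ [b, a] @ zs) []) = Bw"
    using tab_w Row2_two_row_tableau[of Aw Bw] by metis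
  ultimately show ?thesis by simp
qed

section \<open>From permutations to words\<close>

lemma subseq_map_upt:
  assumes "subseq xs (map f [p..<q])"
  shows "\<exists>js. xs = map f js \<and> sorted_wrt (<) js \<and> set js \<subseteq> {p..<q}"
proof -
  obtain N where "xs = nths (map f [p..<q]) N" using assms by (auto simp: subseq_conv_nths)
  then have "xs = map f (nths [p..<q] N)" by (simp add: nths_map)
  moreover have "sorted_wrt (<) (nths [p..<q] N)"
    by (simp add: strict_sorted_iff sorted_nths)
  moreover have "set (nths [p..<q] N) \<subseteq> {p..<q}"
    by (metis set_nths_subset set_upt)
  ultimately show ?thesis by blast
qed

lemma word_avoids_321_map:
  assumes "avoids_321 n v"
  shows "word_avoids_321 (map v [1..<Suc n])"
  unfolding word_avoids_321_def
proof clarify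
  fix f g h assume *: "subseq [f, g, h] (map v [1..<Suc n])" and fgh: "g < f" "h < g"
  obtain js where js: "[f, g, h] = map v js" "sorted_wrt (<) js" "set js \<subseteq> {1..<Suc n}"
    using subseq_map_upt[OF *] by metis
  from js(1) obtain p q r where "js = [p, q, r]" "f = v p" "g = v q" "h = v r"
    by (auto simp: Cons_eq_map_conv)
  then show False using js(2,3) fgh assms unfolding avoids_321_def by auto
qed

theorem theorem4p10:
  fixes n i :: nat and v w :: "nat \<Rightarrow> nat"
  assumes "v permutes {1..n}" and "w permutes {1..n}"
    and "fully_commutative n v" and "fully_commutative n w"
    and "w = v \<circ> simple_refl i"
    and "coxeter_length n w = coxeter_length n v + 1"
    and "i \<in> support n v"
    and "insertion_tableau n v \<noteq> insertion_tableau n w"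
  shows "crowded_permutation n w"
proof -
  have i: "i \<in> {1..<n}"
    using assms(7) by (auto simp: support_def reduced_word_def is_word_def)
  have inj: "inj v" using assms(1) by (rule permutes_inj)
  have asc: "v i < v (Suc i)"
  proof (rule ccontr)
    assume "\<not> v i < v (Suc i)"
    then have "v (Suc i) < v i" using permutes_neq[OF assms(1), of i "Suc i"] by simp
    from card_inversions_desc[OF i this] show False
      using assms(5,6) coxeter_length_eq[OF assms(1)] coxeter_length_eq[OF assms(2)] by simp
  qed
  have av: "avoids_321 n v" "avoids_321 n w"
    using assms(1-4) fully_commutative_iff by auto
  define us where "us = map v [1..<i]"
  define zs where "zs = map v [Suc (Suc i)..<Suc n]"
  have upt: "[1..<Suc n] = [1..<i] @ [i, Suc i] @ [Suc (Suc i)..<Suc n]"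
  proof -
    have "[1..<Suc n] = [1..<i] @ [i..<Suc n]"
      using i upt_add_eq_append[of 1 i "Suc n - i"] by simp
    also have "[i..<Suc n] = [i, Suc i] @ [Suc (Suc i)..<Suc n]"
      using i by (simp add: upt_conv_Cons)
    finally show ?thesis .
  qed
  have word_v: "map v [1..<Suc n] = us @ [v i, v (Suc i)] @ zs"
    unfolding us_def zs_def upt by simp
  have word_w: "map w [1..<Suc n] = us @ [v (Suc i), v i] @ zs"
    unfolding us_def zs_def upt assms(5) by (auto simp: simple_refl_eq)
  \<comment> \<open>As \<open>v\<close> does not preserve the finite set \<open>{1..i}\<close>, some
    position \<open>p \<le> i\<close> carries a value above \<open>i\<close>, and some value
    \<open>t \<le> i\<close> sits at a position \<open>q > i\<close>; so
    \<open>v q \<le> i < v p\<close>.\<close>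
  obtain p q where pq: "p \<in> {1..i}" "q \<in> {Suc i..n}" "v q < v p"
  proof -
    have img: "v ` {1..n} = {1..n}" using assms(1) by (rule permutes_image)
    have "v ` {1..i} \<noteq> {1..i}" using assms(1,7) support_iff by blast
    moreover have "card (v ` {1..i}) = card {1..i}"
      using inj by (meson card_image inj_on_subset subset_UNIV)
    ultimately have "\<not> v ` {1..i} \<subseteq> {1..i}" "\<not> {1..i} \<subseteq> v ` {1..i}"
      using card_subset_eq[of "{1..i}" "v ` {1..i}"] card_subset_eq[of "v ` {1..i}" "{1..i}"]
      by auto
    then obtain p t where p: "p \<in> {1..i}" "v p \<notin> {1..i}" and t: "t \<in> {1..i}" "t \<notin> v ` {1..i}"
      by blast
    have "t \<in> v ` {1..n}" using img t(1) i by auto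
    then obtain q where "q \<in> {1..n}" "t = v q" by blast
    moreover have "v p \<in> {1..n}" using img p(1) i by auto
    ultimately show ?thesis using that[of p q] p t by (force simp: not_le)
  qed
  have w: "w i = v (Suc i)" "w (Suc i) = v i" "j \<noteq> i \<Longrightarrow> j \<noteq> Suc i \<Longrightarrow> w j = v j" for j
    using assms(5) by auto
  have no321: "\<not> (1 \<le> j \<and> j < k \<and> k < l \<and> l \<le> n \<and> w k < w j \<and> w l < w k)" for j k l
    using av(2) unfolding avoids_321_def by blast
  \<comment> \<open>The inversion must avoid the swapped pair: if \<open>p = i\<close>, then
    \<open>w\<close> has a 321 pattern at \<open>i\<close>, \<open>Suc i\<close>, \<open>q\<close>;
    if \<open>q = Suc i\<close>, it has one at \<open>p\<close>, \<open>i\<close>,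
    \<open>Suc i\<close>.\<close>
  have "p \<noteq> i"
  proof
    assume "p = i"
    moreover have "q \<noteq> Suc i" using pq asc \<open>p = i\<close> by auto
    ultimately show False
      using no321[of i "Suc i" q] pq asc i w by auto
  qed
  moreover have "q \<noteq> Suc i"
  proof
    assume "q = Suc i"
    then show False
      using no321[of p i "Suc i"] pq asc i w \<open>p \<noteq> i\<close> by auto
  qed
  ultimately have "v p \<in> set us" "v q \<in> set zs"
    using pq unfolding us_def zs_def by (auto simp del: upt_Suc)
  moreover have "distinct (map w [1..<Suc n])" "set (map w [1..<Suc n]) = {1..n}"
    using assms(2) by (auto simp: distinct_map permutes_inj_on atLeastLessThanSuc_atLeastAtMost
        permutes_image simp del: upt_Suc)
  moreover have "word_avoids_321 (map v [1..<Suc n])" "word_avoids_321 (map w [1..<Suc n])"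
    using av word_avoids_321_map by auto
  ultimately have "crowded (int ` Row2 (insertion_tableau n w))"
    using assms(8) asc pq(3) crowded_insertion[of us "v (Suc i)" "v i" zs "v p" "v q" n]
    unfolding insertion_tableau_def word_v word_w by blast
  then show ?thesis
    using assms(4) unfolding crowded_permutation_def by blast
qed

end
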